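(* Let $L$ be a bounded chain, let $n\geqslant 1$, and let $f\colon L^{n}\rightarrow L$ be a discrete Sugeno integral. The following conditions are equivalent: (i) $f$ is a term function. (ii) $f$ is conservative. (iii) $f$ is weakly conservative.
   Context: A bounded chain is a totally ordered set $L$ with least element $0$ and greatest element $1$, viewed as a lattice with $\wedge=\min$, $\vee=\max$. A polynomial function $L^n\to L$ is any function obtained by finitely many applications of: (i) for each $i\in\{1,\ldots,n\}$ and $c\in L$, the projection $\mathbf{x}\mapsto x_i$ and the constant function $\mathbf{x}\mapsto c$ are polynomial functions; (ii) if $f,g$ are polynomial functions then so are $f\vee g$ and $f\wedge g$ (pointwise). A term function is a function $L^n\to L$ obtained from the projections only (no constants) by finitely many applications of rule (ii). A discrete Sugeno integral is a polynomial function $f\colon L^n\to L$ that is $\{0,1\}$-idempotent, i.e. $f(0,\ldots,0)=0$ and $f(1,\ldots,1)=1$. $f\colon L^n\to L$ is conservative if $f(\mathbf{x})\in\{x_1,\ldots,x_n\}$ for every $\mathbf{x}\in L^n$, and weakly conservative if $f(\mathbf{x})\in\{x_1,\ldots,x_n\}$ for every $\mathbf{x}\in\{0,1\}^n$. *)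

theory Defs
  imports "HOL-Analysis.Finite_Cartesian_Product"
begin

(* A bounded chain is a type of sort {linorder, order_bot, order_top}, with 0 = bot and 1 = top;
   bot = top is allowed.  The space L^n is 'a ^ 'n with CARD('n) = n; as HOL types are
   nonempty, n >= 1 holds automatically. *)

inductive polynomial_function ::
    "(('a::{linorder,order_bot,order_top}) ^ ('n::finite) \<Rightarrow> 'a) \<Rightarrow> bool" where
  proj: "polynomial_function (\<lambda>x. x $ i)"
| const: "polynomial_function (\<lambda>x. c)"
| max: "polynomial_function f \<Longrightarrow> polynomial_function g \<Longrightarrow>
    polynomial_function (\<lambda>x. max (f x) (g x))"
| min: "polynomial_function f \<Longrightarrow> polynomial_function g \<Longrightarrow>
    polynomial_function (\<lambda>x. min (f x) (g x))"

inductive term_function ::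
    "(('a::{linorder,order_bot,order_top}) ^ ('n::finite) \<Rightarrow> 'a) \<Rightarrow> bool" where
  proj: "term_function (\<lambda>x. x $ i)"
| max: "term_function f \<Longrightarrow> term_function g \<Longrightarrow> term_function (\<lambda>x. max (f x) (g x))"
| min: "term_function f \<Longrightarrow> term_function g \<Longrightarrow> term_function (\<lambda>x. min (f x) (g x))"

definition discrete_Sugeno_integral ::
    "(('a::{linorder,order_bot,order_top}) ^ ('n::finite) \<Rightarrow> 'a) \<Rightarrow> bool" where
  "discrete_Sugeno_integral f \<longleftrightarrow>
     polynomial_function f \<and> f (\<chi> i. bot) = bot \<and> f (\<chi> i. top) = top"

definition conservative :: "('a ^ ('n::finite) \<Rightarrow> 'a) \<Rightarrow> bool" where
  "conservative f \<longleftrightarrow> (\<forall>x. f x \<in> {x $ i | i. True})"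

definition weakly_conservative ::
    "(('a::{linorder,order_bot,order_top}) ^ ('n::finite) \<Rightarrow> 'a) \<Rightarrow> bool" where
  "weakly_conservative f \<longleftrightarrow>
     (\<forall>x. (\<forall>i. x $ i \<in> {bot, top}) \<longrightarrow> f x \<in> {x $ i | i. True})"

end

theory Submission
  imports Defs
begin

text \<open>
  Conservativity of term functions is immediate, since \<open>max\<close> and \<open>min\<close> on a chain select one of
  their arguments.  The substance is that a weakly conservative discrete Sugeno integral \<open>f\<close> is a
  term function.

  A polynomial function is compatible with thresholds: whether \<open>t \<le> f x\<close> depends only on whether
  \<open>t \<le> f \<bold>1\<^sub>A\<close> for the set \<open>A\<close> of coordinates with \<open>t \<le> x\<^sub>i\<close>
  (\<open>polynomial_function_threshold\<close>), where \<open>\<bold>1\<^sub>A\<close> is the Boolean vector of \<open>A\<close>.  So \<open>f\<close> is determined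
  by the capacity \<open>A \<mapsto> f \<bold>1\<^sub>A\<close>, as in the usual disjunctive normal form
  \<open>f x = \<Or>\<^sub>A (f \<bold>1\<^sub>A \<and> \<And>\<^bsub>i\<in>A\<^esub> x\<^sub>i)\<close> of a Sugeno integral.  Weak conservativity says exactly that
  the capacity has values in \<open>{bot, top}\<close>.  Its coefficients can then be dropped from the normal form
  by keeping only the sets of capacity \<open>top\<close> (\<open>Boolean_capacity_normal_form\<close>), and what remains is
  a lattice term.  The conditions \<open>f \<bold>1\<^bsub>{}\<^esub> = bot\<close> and \<open>f \<bold>1\<^bsub>UNIV\<^esub> = top\<close> serve to make all joins
  and meets in this term nonempty.
\<close>

definition indicator_vec :: "'n set \<Rightarrow> ('a::{linorder,order_bot,order_top}) ^ ('n::finite)" where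
  "indicator_vec A = (\<chi> i. if i \<in> A then top else bot)"

text \<open>
  On a chain, \<open>t \<le> _\<close> turns \<open>max\<close> and \<open>min\<close> into disjunction and conjunction, so the equivalence
  passes from the projections and the constants to all polynomial functions.
\<close>

lemma polynomial_function_threshold:
  assumes "polynomial_function f"
  shows "t \<le> f x \<longleftrightarrow> t \<le> f (indicator_vec {i. t \<le> x $ i})"
  using assms
proof induction
  case (proj i)
  show ?case
    by (auto simp: indicator_vec_def dest: order_trans[OF _ bot_least])
qed (auto simp: le_max_iff_disj)

lemma polynomial_function_mono:
  assumes "polynomial_function f" and "\<And>i. x $ i \<le> y $ i"
  shows "f x \<le> f y"
  using assms by induction (auto simp: le_max_iff_disj min_le_iff_disj)

lemma term_function_Max:
  assumes "finite I" and "I \<noteq> {}" and "\<And>i. i \<in> I \<Longrightarrow> term_function (F i)"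
  shows "term_function (\<lambda>x. Max ((\<lambda>i. F i x) ` I))"
  using assms by (induction rule: finite_ne_induct) (auto intro: term_function.max)

lemma term_function_Min:
  assumes "finite I" and "I \<noteq> {}" and "\<And>i. i \<in> I \<Longrightarrow> term_function (F i)"
  shows "term_function (\<lambda>x. Min ((\<lambda>i. F i x) ` I))"
  using assms by (induction rule: finite_ne_induct) (auto intro: term_function.min)

lemma term_function_imp_conservative:
  assumes "term_function f"
  shows "conservative f"
  using assms by induction (auto simp: conservative_def max_def min_def)

lemma weakly_conservative_indicator_vec:
  assumes "weakly_conservative f"
  shows "f (indicator_vec A) \<in> {bot, top}"
proof -
  have "\<forall>i. indicator_vec A $ i \<in> {bot, top}"
    by (simp add: indicator_vec_def)
  with assms obtain i where "f (indicator_vec A) = indicator_vec A $ i"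
    unfolding weakly_conservative_def by blast
  then show ?thesis
    by (simp add: indicator_vec_def)
qed

text \<open>
  Each set \<open>S\<close> of capacity \<open>top\<close> contributes a lower bound of \<open>f x\<close>: thresholding \<open>x\<close> at its minimum over
  \<open>S\<close> retains all of \<open>S\<close>.  Conversely, unless \<open>f x = bot\<close>, the value \<open>f x\<close> is dominated by the meet
  over one such set, namely the set obtained by thresholding \<open>x\<close> at \<open>f x\<close> itself.
\<close>

lemma Boolean_capacity_normal_form:
  fixes f :: "('a::{linorder,order_bot,order_top}) ^ ('n::finite) \<Rightarrow> 'a"
  assumes "discrete_Sugeno_integral f"
    and Boolean: "\<And>A. f (indicator_vec A) \<in> {bot, top}"
  defines "T \<equiv> {A. A \<noteq> {} \<and> f (indicator_vec A) = top}"
  shows "T \<noteq> {}" and "f x = Max ((\<lambda>S. Min ((\<lambda>i. x $ i) ` S)) ` T)"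
proof -
  have poly: "polynomial_function f"
    and empty: "f (indicator_vec {}) = bot" and univ: "f (indicator_vec UNIV) = top"
    using assms(1) by (simp_all add: discrete_Sugeno_integral_def indicator_vec_def)
  show T: "T \<noteq> {}"
    using univ by (auto simp: T_def)
  let ?m = "\<lambda>S. Min ((\<lambda>i. x $ i) ` S)"
  show "f x = Max (?m ` T)"
  proof (rule antisym)
    have "?m S \<le> f x" if "S \<in> T" for S
    proof -
      have "S \<subseteq> {i. ?m S \<le> x $ i}"
        by auto
      then have "f (indicator_vec S) \<le> f (indicator_vec {i. ?m S \<le> x $ i})"
        by (intro polynomial_function_mono[OF poly]) (auto simp: indicator_vec_def)
      with that have "?m S \<le> f (indicator_vec {i. ?m S \<le> x $ i})"
        by (simp add: T_def top_unique)
      then show ?thesis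
        using polynomial_function_threshold[OF poly] by blast
    qed
    with T show "Max (?m ` T) \<le> f x"
      by auto
  next
    define A where "A = {i. f x \<le> x $ i}"
    have le: "f x \<le> f (indicator_vec A)"
      unfolding A_def using polynomial_function_threshold[OF poly] by blast
    show "f x \<le> Max (?m ` T)"
    proof (cases "A \<in> T")
      case True
      then have "f x \<le> ?m A"
        by (auto simp: A_def T_def)
      also have "?m A \<le> Max (?m ` T)"
        using True by simp
      finally show ?thesis .
    next
      case False
      with Boolean[of A] empty have "f (indicator_vec A) = bot"
        by (auto simp: T_def)
      with le show ?thesis
        by (simp add: bot_unique)
    qed
  qed
qed

lemma weakly_conservative_imp_term_function:
  assumes "discrete_Sugeno_integral f" and "weakly_conservative f"
  shows "term_function f"
proof -
  define T where "T = {A. A \<noteq> {} \<and> f (indicator_vec A) = top}"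
  note normal_form = Boolean_capacity_normal_form
    [OF assms(1) weakly_conservative_indicator_vec[OF assms(2)], folded T_def]
  have "term_function (\<lambda>x. Max ((\<lambda>S. Min ((\<lambda>i. x $ i) ` S)) ` T))"
    using normal_form(1)
    by (intro term_function_Max term_function_Min term_function.proj) (auto simp: T_def)
  also have "(\<lambda>x. Max ((\<lambda>S. Min ((\<lambda>i. x $ i) ` S)) ` T)) = f"
    using normal_form(2) by (intro ext) simp
  finally show ?thesis .
qed

theorem theorem30:
  fixes f :: "('a::{linorder,order_bot,order_top}) ^ ('n::finite) \<Rightarrow> 'a"
  assumes "discrete_Sugeno_integral f"
  shows "(term_function f \<longleftrightarrow> conservative f) \<and>
         (conservative f \<longleftrightarrow> weakly_conservative f)"
proof -
  have "conservative f \<Longrightarrow> weakly_conservative f"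
    by (simp add: conservative_def weakly_conservative_def)
  with term_function_imp_conservative weakly_conservative_imp_term_function[OF assms]
  show ?thesis
    by blast
qed

end
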